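(* Let $1\le q<\infty$, let $A$ be a nonzero real $N\times n$ matrix with rows $v_1,\dots,v_N\in\mathbb{R}^n$, and let $0<\varepsilon\le(\operatorname{rk}(A))^{-1/q}$. Assume that $$|(v_{i_0},x)|\le\varepsilon\Bigl(\sum_{i=1}^N|(v_i,x)|^q\Bigr)^{1/q}\quad\text{for all } x\in\mathbb{R}^n \text{ and all } i_0\in\{1,\dots,N\}.$$ Then there exists a partition $\{1,\dots,N\}=\Omega_1\cup\Omega_2$, $\Omega_1\cap\Omega_2=\emptyset$, such that for every $x\in\mathbb{R}^n$ and $k=1,2$ $$\|A(\Omega_k)x\|_q\le\gamma\,\|Ax\|_q,$$ where $$\gamma=\frac{1}{2^{1/q}}+\frac{2+3\cdot 2^{-1/q}}{q}\left(\operatorname{rk}(A)\,\varepsilon^q\,\ln\frac{6q}{(\operatorname{rk}(A)\,\varepsilon^q)^{1/3}}\right)^{1/3}.$$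
   Context: $\operatorname{rk}(A)$ is the rank of $A$; $(\cdot,\cdot)$ is the standard inner product on $\mathbb{R}^n$; $\|\cdot\|_q$ is the $\ell_q$-norm. For $\omega\subset\{1,\dots,N\}$, $A(\omega)$ is the submatrix of $A$ formed by the rows $v_i$, $i\in\omega$, so $\|A(\omega)x\|_q=\bigl(\sum_{i\in\omega}|(v_i,x)|^q\bigr)^{1/q}$ (equal to $0$ if $\omega=\emptyset$). The parts of a partition are only required to be disjoint with union $\{1,\dots,N\}$. *)

theory Defs
  imports "HOL-Analysis.Analysis"
begin

text \<open>The library has no \<open>\<ell>\<^sub>q\<close>-norm for real exponents \<open>q\<close>.
  The coordinate set \<open>I\<close> is explicit because restricting it is how submatrices enter. Since
  \<open>0 powr q = 0\<close> in HOL, zero coordinates contribute \<open>0\<close> and the value for \<open>I = {}\<close> is \<open>0\<close>.\<close>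

definition lq_norm_on :: "real \<Rightarrow> 'i set \<Rightarrow> ('i \<Rightarrow> real) \<Rightarrow> real" where
  "lq_norm_on q I f = (\<Sum>i\<in>I. \<bar>f i\<bar> powr q) powr (1 / q)"

definition lq_norm :: "real \<Rightarrow> real ^ 'm \<Rightarrow> real" where
  "lq_norm q y = lq_norm_on q UNIV (\<lambda>i. y $ i)"

text \<open>\<open>\<parallel>A(\<omega>)x\<parallel>\<^sub>q\<close>, where \<open>A(\<omega>)\<close> is the submatrix of \<open>A\<close> formed by the rows with index in
  \<open>\<omega>\<close>. As \<open>\<omega>\<close> is an arbitrary set, possibly empty, \<open>A(\<omega>)\<close> itself is not of a matrix type;
  its action on \<open>x\<close> is the family of the numbers \<open>row i A \<bullet> x\<close> for \<open>i \<in> \<omega>\<close>.\<close>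

definition submatrix_lq_norm :: "real \<Rightarrow> real ^ 'n ^ 'm \<Rightarrow> 'm set \<Rightarrow> real ^ 'n \<Rightarrow> real" where
  "submatrix_lq_norm q A \<omega> x = lq_norm_on q \<omega> (\<lambda>i. row i A \<bullet> x)"

end

(* Put the rows into Omega_1 or Omega_2 by independent fair coin flips and let R = rk(A) * eps^q,
   T = (R * ln (6 q / R^(1/3)))^(1/3). For a fixed x with |Ax|_q <= 1, the difference of the two
   sums of |(v_i, x)|^q is a Rademacher sum whose coefficients have square sum at most eps^q, so it
   exceeds 3T only with probability at most 2 exp (- 9 T^2 / (4 eps^q)). Comparing volumes, the unit
   ball of the range of A has a (2T/q)-net of at most (1 + q/T)^rk(A) points; for T < 1 the union
   bound over the net leaves a splitting that is good at every net point, and passing from the net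
   to an arbitrary x costs another 2T/q. For T >= 1 the constant gamma is at least 1. *)
theory Submission
  imports Defs
begin

section \<open>The \<open>\<ell>\<^sub>q\<close>-norm\<close>

text \<open>Positive \<open>a\<close> and \<open>b\<close> are covered by
  \<open>powr_convex\<close>; an endpoint 0 is covered by \<open>w powr q \<le> w\<close> for
  \<open>w\<close> in [0, 1].\<close>

lemma powr_convex_combination:
  fixes a b u v q :: real
  assumes "1 \<le> q" "0 \<le> a" "0 \<le> b" "0 \<le> u" "0 \<le> v" "u + v = 1"
  shows "(u * a + v * b) powr q \<le> u * a powr q + v * b powr q"
proof -
  have scale: "(w * c) powr q \<le> w * c powr q" if "0 \<le> w" "w \<le> 1" "0 \<le> c" for w c :: real
  proof -
    have "w powr q \<le> w"
      using that assms(1) powr_mono'[of 1 q w] by (cases "w = 0") auto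
    then show ?thesis
      using that by (simp add: powr_mult mult_right_mono)
  qed
  show ?thesis
  proof (cases "a = 0 \<or> b = 0")
    case True
    then show ?thesis
      using scale[of u a] scale[of v b] assms by auto
  next
    case False
    then have "a \<in> {0<..}" "b \<in> {0<..}"
      using assms by auto
    moreover have "u = 1 - v" "v \<le> 1"
      using assms by auto
    ultimately show ?thesis
      using convex_onD[OF powr_convex[OF assms(1)], of v a b] assms(5) by simp
  qed
qed

text \<open>Bernoulli's inequality, as weighted AM-GM for \<open>1 + s\<close> and \<open>1\<close>
  with weights \<open>1 / q\<close> and \<open>1 - 1 / q\<close>.\<close>

lemma one_plus_powr_le:
  fixes s q :: real
  assumes "1 \<le> q" "0 \<le> s"
  shows "(1 + s) powr (1 / q) \<le> 1 + s / q"
proof -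
  have "(1 + s) powr (1 / q) \<le> 1 / q * (1 + s) + (1 - 1 / q)"
    using Youngs_inequality_0[of "1 / q" "1 - 1 / q" "1 + s" 1] assms by simp
  also have "\<dots> = 1 + s / q"
    by (simp add: add_divide_distrib)
  finally show ?thesis .
qed

lemma lq_norm_on_nonneg [simp]: "0 \<le> lq_norm_on q I f"
  by (simp add: lq_norm_on_def)

lemma lq_norm_on_powr:
  assumes "0 < q"
  shows "lq_norm_on q I f powr q = (\<Sum>i\<in>I. \<bar>f i\<bar> powr q)"
  using assms by (simp add: lq_norm_on_def powr_powr sum_nonneg)

lemma lq_norm_on_cmult:
  assumes "0 < q"
  shows "lq_norm_on q I (\<lambda>i. c * f i) = \<bar>c\<bar> * lq_norm_on q I f"
proof -
  have "(\<Sum>i\<in>I. \<bar>c * f i\<bar> powr q) = \<bar>c\<bar> powr q * (\<Sum>i\<in>I. \<bar>f i\<bar> powr q)"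
    by (simp add: abs_mult powr_mult sum_distrib_left)
  then show ?thesis
    using assms by (simp add: lq_norm_on_def powr_mult powr_powr sum_nonneg)
qed

lemma lq_norm_on_mono:
  assumes "0 < q" "finite J" "I \<subseteq> J"
  shows "lq_norm_on q I f \<le> lq_norm_on q J f"
  unfolding lq_norm_on_def using assms
  by (intro powr_mono2 sum_mono2) (auto intro: sum_nonneg)

lemma lq_norm_on_mono_fun:
  assumes "0 < q" "\<And>i. i \<in> I \<Longrightarrow> \<bar>f i\<bar> \<le> \<bar>g i\<bar>"
  shows "lq_norm_on q I f \<le> lq_norm_on q I g"
  unfolding lq_norm_on_def using assms
  by (intro powr_mono2 sum_mono) (auto intro: sum_nonneg)

lemma abs_le_lq_norm_on:
  assumes "0 < q" "finite I" "i \<in> I"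
  shows "\<bar>f i\<bar> \<le> lq_norm_on q I f"
  using lq_norm_on_mono[of q I "{i}" f] assms by (simp add: lq_norm_on_def powr_powr)

lemma lq_norm_on_eq_0_imp:
  assumes "0 < q" "finite I" "lq_norm_on q I f = 0" "i \<in> I"
  shows "f i = 0"
  using abs_le_lq_norm_on[OF assms(1,2,4), of f] assms(3) by simp

text \<open>Minkowski's inequality. After division by \<open>a + b\<close> the sum is dominated by
  the convex combination, with weights \<open>u\<close> and \<open>v\<close>, of
  \<open>\<bar>f i\<bar> / a\<close> and \<open>\<bar>g i\<bar> / b\<close>, both of norm 1;
  convexity of the q-th power is then summed over \<open>I\<close>. If \<open>a\<close> or
  \<open>b\<close> is 0, that function vanishes on \<open>I\<close>.\<close>

lemma lq_norm_on_triangle: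
  assumes "1 \<le> q" "finite I"
  shows "lq_norm_on q I (\<lambda>i. f i + g i) \<le> lq_norm_on q I f + lq_norm_on q I g"
proof -
  define a b where "a = lq_norm_on q I f" and "b = lq_norm_on q I g"
  have q: "0 < q" using assms by simp
  show ?thesis
  proof (cases "a = 0 \<or> b = 0")
    case True
    then have "(\<forall>i\<in>I. f i = 0) \<or> (\<forall>i\<in>I. g i = 0)"
      using lq_norm_on_eq_0_imp[OF q assms(2)] unfolding a_def b_def by metis
    then show ?thesis
    proof
      assume "\<forall>i\<in>I. f i = 0"
      then have "lq_norm_on q I (\<lambda>i. f i + g i) = lq_norm_on q I g"
        unfolding lq_norm_on_def by (intro arg_cong2[where f="(powr)"] sum.cong) auto
      then show ?thesis by simp
    next
      assume "\<forall>i\<in>I. g i = 0"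
      then have "lq_norm_on q I (\<lambda>i. f i + g i) = lq_norm_on q I f"
        unfolding lq_norm_on_def by (intro arg_cong2[where f="(powr)"] sum.cong) auto
      then show ?thesis by simp
    qed
  next
    case False
    then have ab: "0 < a" "0 < b"
      using lq_norm_on_nonneg[of q I f] lq_norm_on_nonneg[of q I g]
      unfolding a_def b_def by linarith+
    define u v where "u = a / (a + b)" and "v = b / (a + b)"
    have uv: "0 \<le> u" "0 \<le> v" "u + v = 1"
      using ab by (auto simp: u_def v_def add_divide_distrib[symmetric])
    have pt: "\<bar>f i + g i\<bar> powr q
        \<le> (a + b) powr q * (u * (\<bar>f i\<bar> powr q / a powr q) + v * (\<bar>g i\<bar> powr q / b powr q))" for i
    proof -
      have "(a + b) * u = a" "(a + b) * v = b"
        using ab by (simp_all add: u_def v_def)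
      then have "(a + b) * (u * (\<bar>f i\<bar> / a) + v * (\<bar>g i\<bar> / b)) = \<bar>f i\<bar> + \<bar>g i\<bar>"
        using ab by (simp add: distrib_left mult.assoc[symmetric])
      then have "\<bar>f i + g i\<bar> \<le> (a + b) * (u * (\<bar>f i\<bar> / a) + v * (\<bar>g i\<bar> / b))"
        by simp
      then have "\<bar>f i + g i\<bar> powr q \<le> ((a + b) * (u * (\<bar>f i\<bar> / a) + v * (\<bar>g i\<bar> / b))) powr q"
        using q by (intro powr_mono2) auto
      also have "\<dots> = (a + b) powr q * (u * (\<bar>f i\<bar> / a) + v * (\<bar>g i\<bar> / b)) powr q"
        by (rule powr_mult)
      also have "\<dots> \<le> (a + b) powr q * (u * (\<bar>f i\<bar> / a) powr q + v * (\<bar>g i\<bar> / b) powr q)"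
        using ab uv assms by (intro mult_left_mono powr_convex_combination) auto
      finally show ?thesis
        using ab by (simp add: powr_divide)
    qed
    have "(\<Sum>i\<in>I. \<bar>f i + g i\<bar> powr q)
        \<le> (\<Sum>i\<in>I. (a + b) powr q * (u * (\<bar>f i\<bar> powr q / a powr q) + v * (\<bar>g i\<bar> powr q / b powr q)))"
      by (intro sum_mono pt)
    also have "\<dots> = (a + b) powr q * (u * ((\<Sum>i\<in>I. \<bar>f i\<bar> powr q) / a powr q)
                                  + v * ((\<Sum>i\<in>I. \<bar>g i\<bar> powr q) / b powr q))"
      by (simp add: sum_distrib_left[symmetric] sum.distrib sum_divide_distrib[symmetric]
          times_divide_eq_right[symmetric] del: times_divide_eq_right)
    also have "\<dots> = (a + b) powr q"
      using ab uv by (simp add: lq_norm_on_powr[OF q, symmetric] a_def[symmetric] b_def[symmetric])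
    finally have "(\<Sum>i\<in>I. \<bar>f i + g i\<bar> powr q) powr (1 / q) \<le> ((a + b) powr q) powr (1 / q)"
      using q by (intro powr_mono2) (auto intro: sum_nonneg)
    then show ?thesis
      using q ab by (simp add: powr_powr lq_norm_on_def[of q I "\<lambda>i. f i + g i"] a_def[symmetric] b_def[symmetric])
  qed
qed

section \<open>Balanced subsets\<close>

text \<open>A subgaussian bound on cosh, with \<open>x\<^sup>2\<close> in place of the sharp
  exponent \<open>x\<^sup>2 / 2\<close>. On [0, 1] the bounds \<open>1 + y + y\<^sup>2\<close> and
  \<open>1 - y + y\<^sup>2\<close> are added and the linear terms cancel; beyond 1 both exponents
  are at most \<open>y\<^sup>2\<close>.\<close>

lemma exp_plus_exp_minus_le:
  fixes x :: real
  shows "exp x + exp (- x) \<le> 2 * exp (x\<^sup>2)"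
proof -
  have nonneg: "exp y + exp (- y) \<le> 2 * exp (y\<^sup>2)" if y: "0 \<le> y" for y :: real
  proof (cases "y \<le> 1")
    case True
    have pos: "0 < 1 + y" "0 \<le> y ^ 3" using y by auto
    have "exp (- y) = 1 / exp y"
      by (simp add: exp_minus field_simps)
    also have "\<dots> \<le> 1 / (1 + y)"
      using pos exp_ge_add_one_self[of y] by (intro divide_left_mono) auto
    also have "\<dots> \<le> 1 - y + y\<^sup>2"
    proof -
      have "1 \<le> (1 - y + y\<^sup>2) * (1 + y)"
        using pos(2) by (simp add: algebra_simps power2_eq_square power3_eq_cube)
      then show ?thesis
        using pos(1) by (simp only: pos_divide_le_eq)
    qed
    finally show ?thesis
      using exp_bound[OF y True] exp_ge_add_one_self[of "y\<^sup>2"] by linarith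
  next
    case False
    then have "y \<le> y\<^sup>2" by (simp add: power2_eq_square)
    moreover have "- y \<le> y\<^sup>2" using y by (smt (verit) zero_le_power2)
    ultimately show ?thesis
      by (smt (verit) exp_le_cancel_iff)
  qed
  show ?thesis
    using nonneg[of x] nonneg[of "- x"] by (cases "0 \<le> x") auto
qed

text \<open>Up to the factor \<open>2 ^ card I\<close> the left side is the moment generating
  function of a Rademacher sum. Summing over all sign patterns amounts to expanding the product of
  the \<open>exp (t * a i) + exp (- (t * a i))\<close>, each bounded by the cosh estimate.\<close>

lemma sum_exp_signed_sum_le:
  fixes a :: "'i \<Rightarrow> real"
  assumes "finite I"
  shows "(\<Sum>\<Omega>\<in>Pow I. exp (t * (sum a \<Omega> - sum a (I - \<Omega>)))) \<le> 2 ^ card I * exp (t\<^sup>2 * (\<Sum>i\<in>I. (a i)\<^sup>2))"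
proof -
  have "(\<Sum>\<Omega>\<in>Pow I. exp (t * (sum a \<Omega> - sum a (I - \<Omega>))))
      = (\<Sum>\<Omega>\<in>Pow I. (\<Prod>i\<in>\<Omega>. exp (t * a i)) * (\<Prod>i\<in>I - \<Omega>. exp (- (t * a i))))"
  proof (intro sum.cong refl)
    fix \<Omega> assume "\<Omega> \<in> Pow I"
    then have "finite \<Omega>" "finite (I - \<Omega>)"
      using assms by (auto intro: finite_subset)
    then show "exp (t * (sum a \<Omega> - sum a (I - \<Omega>)))
        = (\<Prod>i\<in>\<Omega>. exp (t * a i)) * (\<Prod>i\<in>I - \<Omega>. exp (- (t * a i)))"
      by (simp add: exp_sum[symmetric] exp_add[symmetric] sum_negf sum_distrib_left algebra_simps)
  qed
  also have "\<dots> = (\<Prod>i\<in>I. exp (t * a i) + exp (- (t * a i)))"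
    by (rule prod_add[OF assms, symmetric])
  also have "\<dots> \<le> (\<Prod>i\<in>I. 2 * exp ((t * a i)\<^sup>2))"
    by (intro prod_mono) (auto intro: exp_plus_exp_minus_le add_nonneg_nonneg)
  also have "\<dots> = 2 ^ card I * exp (t\<^sup>2 * (\<Sum>i\<in>I. (a i)\<^sup>2))"
    using assms by (simp add: prod.distrib exp_sum sum_distrib_left power_mult_distrib)
  finally show ?thesis .
qed

text \<open>Chernoff bound and union bound, as counting over \<open>Pow I\<close>: if every
  \<open>\<Omega>\<close> failed at some \<open>y\<close>, the exponential moments over all
  \<open>y\<close> and both signs would add up to at least \<open>2 ^ card I * exp (t * s)\<close>,
  too much for so small a \<open>P\<close>.\<close>

lemma exists_balanced_subset:
  fixes a :: "'y \<Rightarrow> 'i \<Rightarrow> real"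
  assumes "finite I" "finite P" "0 < s" "0 < \<sigma>"
    and sq: "\<And>y. y \<in> P \<Longrightarrow> (\<Sum>i\<in>I. (a y i)\<^sup>2) \<le> \<sigma>"
    and small: "2 * real (card P) < exp (s\<^sup>2 / (4 * \<sigma>))"
  shows "\<exists>\<Omega>\<subseteq>I. \<forall>y\<in>P. \<bar>sum (a y) \<Omega> - sum (a y) (I - \<Omega>)\<bar> \<le> s"
proof (rule ccontr)
  define Z where "Z y \<Omega> = sum (a y) \<Omega> - sum (a y) (I - \<Omega>)" for y \<Omega>
  \<comment> \<open>This \<open>t\<close> minimises \<open>t\<^sup>2 * \<sigma> - t * s\<close>,
    with minimum \<open>- s\<^sup>2 / (4 * \<sigma>)\<close>.\<close>
  define t where "t = s / (2 * \<sigma>)"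
  have t: "0 < t" using assms by (simp add: t_def)
  assume "\<not> (\<exists>\<Omega>\<subseteq>I. \<forall>y\<in>P. \<bar>sum (a y) \<Omega> - sum (a y) (I - \<Omega>)\<bar> \<le> s)"
  then have bad: "\<forall>\<Omega>\<in>Pow I. \<exists>y\<in>P. s < \<bar>Z y \<Omega>\<bar>"
    unfolding Z_def by (meson PowD not_le)
  have lower: "exp (t * s) \<le> (\<Sum>y\<in>P. exp (t * Z y \<Omega>) + exp ((- t) * Z y \<Omega>))"
    if \<Omega>: "\<Omega> \<in> Pow I" for \<Omega>
  proof -
    obtain y where y: "y \<in> P" "s < \<bar>Z y \<Omega>\<bar>" using bad \<Omega> by blast
    have "exp (t * s) \<le> exp (t * \<bar>Z y \<Omega>\<bar>)"
      using y t by simp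
    also have "\<dots> \<le> exp (t * Z y \<Omega>) + exp ((- t) * Z y \<Omega>)"
      by (cases "0 \<le> Z y \<Omega>") auto
    also have "\<dots> \<le> (\<Sum>y\<in>P. exp (t * Z y \<Omega>) + exp ((- t) * Z y \<Omega>))"
      using y assms by (intro member_le_sum) (auto intro: add_nonneg_nonneg)
    finally show ?thesis .
  qed
  have moment: "(\<Sum>\<Omega>\<in>Pow I. exp (r * Z y \<Omega>)) \<le> 2 ^ card I * exp (t\<^sup>2 * \<sigma>)"
    if "y \<in> P" "r\<^sup>2 = t\<^sup>2" for y r
  proof -
    have "(\<Sum>\<Omega>\<in>Pow I. exp (r * Z y \<Omega>)) \<le> 2 ^ card I * exp (r\<^sup>2 * (\<Sum>i\<in>I. (a y i)\<^sup>2))"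
      unfolding Z_def by (rule sum_exp_signed_sum_le[OF assms(1)])
    also have "\<dots> \<le> 2 ^ card I * exp (t\<^sup>2 * \<sigma>)"
      using sq[OF that(1)] that(2) by (simp add: mult_left_mono)
    finally show ?thesis .
  qed
  have "2 ^ card I * exp (t * s) = (\<Sum>\<Omega>\<in>Pow I. exp (t * s))"
    using assms by (simp add: card_Pow)
  also have "\<dots> \<le> (\<Sum>\<Omega>\<in>Pow I. \<Sum>y\<in>P. exp (t * Z y \<Omega>) + exp ((- t) * Z y \<Omega>))"
    by (intro sum_mono lower)
  also have "\<dots> = (\<Sum>y\<in>P. (\<Sum>\<Omega>\<in>Pow I. exp (t * Z y \<Omega>)) + (\<Sum>\<Omega>\<in>Pow I. exp ((- t) * Z y \<Omega>)))"
    by (subst sum.swap) (simp add: sum.distrib)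
  also have "\<dots> \<le> (\<Sum>y\<in>P. 2 ^ card I * exp (t\<^sup>2 * \<sigma>) + 2 ^ card I * exp (t\<^sup>2 * \<sigma>))"
    by (intro sum_mono add_mono moment) auto
  also have "\<dots> = 2 ^ card I * (2 * real (card P) * exp (t\<^sup>2 * \<sigma>))"
    by simp
  finally have "exp (t * s) \<le> 2 * real (card P) * exp (t\<^sup>2 * \<sigma>)"
    by (simp only: mult_le_cancel_left_pos zero_less_power zero_less_numeral)
  also have "\<dots> < exp (s\<^sup>2 / (4 * \<sigma>)) * exp (t\<^sup>2 * \<sigma>)"
    using small by simp
  also have "\<dots> = exp (t * s)"
    using assms by (simp add: exp_add[symmetric] t_def field_simps power2_eq_square)
  finally show False by simp
qed

section \<open>Nets in subspaces\<close>

text \<open>Dimensions are types, so the \<open>rank A\<close>-dimensional range of \<open>A\<close> is modelled by the vectors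
  supported on a set \<open>J\<close> of coordinates of the full space, on which \<open>p\<close> is a norm. Taking the
  product of a \<open>p\<close>-ball with a fixed cube in the other coordinates makes the full Lebesgue measure
  scale with the exponent \<open>card J\<close>.\<close>

locale coordinate_norm =
  fixes p :: "real ^ 'n \<Rightarrow> real" and J :: "'n set" and e C :: real
  assumes scale: "p (c *\<^sub>R x) = \<bar>c\<bar> * p x"
    and triangle: "p (x + y) \<le> p x + p y"
    and upper: "p x \<le> C * norm x"
    and lower: "(\<And>i. i \<notin> J \<Longrightarrow> x $ i = 0) \<Longrightarrow> e * norm x \<le> p x"
    and e_pos: "0 < e"
begin

definition proj :: "real ^ 'n \<Rightarrow> real ^ 'n" where
  "proj x = (\<chi> i. if i \<in> J then x $ i else 0)"

definition cylinder :: "real \<Rightarrow> (real ^ 'n) set" where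
  "cylinder r = {x. p (proj x) \<le> r \<and> (\<forall>i. i \<notin> J \<longrightarrow> \<bar>x $ i\<bar> \<le> 1)}"

lemma p_minus: "p (- x) = p x"
  using scale[of "-1" x] by simp

lemma p_zero: "p 0 = 0"
  using scale[of 0 0] by simp

lemma p_nonneg: "0 \<le> p x"
  using triangle[of x "- x"] by (simp add: p_minus p_zero)

lemma p_diff_commute: "p (x - y) = p (y - x)"
  using p_minus[of "x - y"] by simp

lemma linear_proj: "linear proj"
  by (rule linearI) (simp_all add: proj_def vec_eq_iff)

lemma norm_proj_le: "norm (proj x) \<le> norm x"
  by (rule norm_le_componentwise_cart) (simp add: proj_def)

lemma proj_id: "(\<And>i. i \<notin> J \<Longrightarrow> x $ i = 0) \<Longrightarrow> proj x = x"
  by (simp add: proj_def vec_eq_iff)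

lemma C_nonneg: "0 \<le> C"
proof -
  have "0 \<le> C * norm (axis undefined 1 :: real ^ 'n)"
    using upper p_nonneg order_trans by blast
  then show ?thesis by simp
qed

lemma continuous_p: "continuous_on UNIV p"
proof (rule lipschitz_on_continuous_on)
  show "C-lipschitz_on UNIV p"
  proof (rule lipschitz_onI)
    fix x y :: "real ^ 'n"
    have "p x \<le> p y + p (x - y)" "p y \<le> p x + p (x - y)"
      using triangle[of y "x - y"] triangle[of x "y - x"] by (simp_all add: p_diff_commute)
    then show "dist (p x) (p y) \<le> C * dist x y"
      using upper[of "x - y"] by (simp add: dist_norm abs_le_iff)
  qed (rule C_nonneg)
qed

text \<open>Ensures finite measure. \<open>lower\<close> bounds the coordinates in \<open>J\<close>,
  since \<open>proj x\<close> is supported there; the cube bounds the others.\<close>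

lemma compact_cylinder: "compact (cylinder r)"
proof -
  have "continuous_on UNIV proj"
    using linear_proj linear_continuous_on linear_conv_bounded_linear by blast
  then have "continuous_on UNIV (\<lambda>x. p (proj x))"
    using continuous_on_compose2[OF continuous_p] by blast
  then have "closed (cylinder r)"
    unfolding cylinder_def
    by (intro closed_Collect_conj closed_Collect_all closed_Collect_imp closed_Collect_le
        continuous_intros) auto
  moreover have "bounded (cylinder r)"
  proof (rule boundedI)
    fix x assume x: "x \<in> cylinder r"
    have "e * norm (proj x) \<le> r"
      using lower[of "proj x"] x by (force simp: cylinder_def proj_def)
    then have "norm (proj x) \<le> r / e"
      using e_pos by (simp add: field_simps)
    moreover have "\<bar>x $ i\<bar> \<le> norm (proj x) + 1" for i
      using component_le_norm_cart[of "proj x" i] x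
      by (cases "i \<in> J") (auto simp: cylinder_def proj_def intro: add_increasing)
    ultimately have "\<bar>x $ i\<bar> \<le> r / e + 1" for i
      by (meson add_right_mono order_trans)
    then have "(\<Sum>i\<in>UNIV. \<bar>x $ i\<bar>) \<le> real CARD('n) * (r / e + 1)"
      by (intro sum_bounded_above) auto
    then show "norm x \<le> real CARD('n) * (r / e + 1)"
      using norm_le_l1_cart[of x] by linarith
  qed
  ultimately show ?thesis
    by (simp add: compact_eq_bounded_closed)
qed

lemma lmeasurable_cylinder: "cylinder r \<in> lmeasurable"
  by (rule lmeasurable_compact[OF compact_cylinder])

lemma measure_cylinder_1_pos: "0 < measure lebesgue (cylinder 1)"
proof -
  define r where "r = 1 / (C + 1)"
  have r: "0 < r" "r \<le> 1" "C * r \<le> 1"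
    using C_nonneg by (auto simp: r_def field_simps)
  have "ball 0 r \<subseteq> cylinder 1"
  proof
    fix x :: "real ^ 'n" assume "x \<in> ball 0 r"
    then have x: "norm x \<le> r" by simp
    have "p (proj x) \<le> C * norm (proj x)" by (rule upper)
    also have "\<dots> \<le> C * r"
      using x norm_proj_le[of x] C_nonneg by (intro mult_left_mono) auto
    finally have "p (proj x) \<le> 1" using r by simp
    moreover have "\<bar>x $ i\<bar> \<le> 1" for i
      using component_le_norm_cart[of x i] x r by linarith
    ultimately show "x \<in> cylinder 1" by (simp add: cylinder_def)
  qed
  then have "measure lebesgue (ball (0 :: real ^ 'n) r) \<le> measure lebesgue (cylinder 1)"
    by (intro measure_mono_fmeasurable lmeasurable_cylinder) auto
  then show ?thesis
    using less_le_trans[OF content_ball_pos[OF r(1), of "0 :: real ^ 'n"]] by simp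
qed

text \<open>The diagonal map that stretches the \<open>J\<close>-coordinates by \<open>r\<close> and
  fixes the others takes \<open>cylinder 1\<close> onto \<open>cylinder r\<close>; its determinant
  is \<open>r ^ card J\<close>.\<close>

lemma measure_cylinder:
  assumes "0 < r"
  shows "measure lebesgue (cylinder r) = r ^ card J * measure lebesgue (cylinder 1)"
proof -
  define m where "m i = (if i \<in> J then r else 1)" for i :: 'n
  have proj_stretch: "proj (\<chi> k. m k * x $ k) = r *\<^sub>R proj x" for x
    by (simp add: proj_def m_def vec_eq_iff)
  have stretch_mem: "(\<chi> k. m k * x $ k) \<in> cylinder r \<longleftrightarrow> x \<in> cylinder 1" for x
  proof -
    have "(\<forall>i. i \<notin> J \<longrightarrow> \<bar>m i * x $ i\<bar> \<le> 1) \<longleftrightarrow> (\<forall>i. i \<notin> J \<longrightarrow> \<bar>x $ i\<bar> \<le> 1)"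
      by (simp add: m_def)
    then show ?thesis
      using assms by (simp add: cylinder_def proj_stretch scale)
  qed
  have "surj (\<lambda>x. \<chi> k. m k * x $ k)"
  proof (rule surjI)
    show "(\<chi> k. m k * (\<chi> i. y $ i / m i) $ k) = y" for y
      using assms by (simp add: m_def vec_eq_iff)
  qed
  then have "(\<lambda>x. \<chi> k. m k * x $ k) ` ((\<lambda>x. \<chi> k. m k * x $ k) -` cylinder r) = cylinder r"
    by (rule surj_image_vimage_eq)
  then have "cylinder r = (\<lambda>x. \<chi> k. m k * x $ k) ` cylinder 1"
    using stretch_mem by (simp add: vimage_def)
  moreover have "prod m UNIV = r ^ card J"
    by (simp add: m_def prod.If_cases)
  ultimately show ?thesis
    using assms measure_stretch[OF lmeasurable_cylinder, of m 1] by simp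
qed

text \<open>The ball of the \<open>card J\<close>-dimensional normed space itself. It is a Lebesgue
  null set unless \<open>J = UNIV\<close>, which is why volumes are taken of cylinders.\<close>

definition unit_ball :: "(real ^ 'n) set" where
  "unit_ball = {x. (\<forall>i. i \<notin> J \<longrightarrow> x $ i = 0) \<and> p x \<le> 1}"

text \<open>Volume packing: translates of \<open>cylinder (\<delta> / 2)\<close> by separated points
  are disjoint and fit into \<open>cylinder (1 + \<delta> / 2)\<close>. Points of \<open>P\<close>
  vanish outside \<open>J\<close>, so the translations leave the cube coordinates alone and only the
  exponent \<open>card J\<close> enters the ratio.\<close>

lemma card_separated_le:
  assumes "finite P" "P \<subseteq> unit_ball" "0 < \<delta>" and sep: "pairwise (\<lambda>x y. \<delta> < p (x - y)) P"
  shows "real (card P) \<le> (1 + 2 / \<delta>) ^ card J"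
proof -
  define V where "V = measure lebesgue (cylinder 1)"
  have V: "0 < V" unfolding V_def by (rule measure_cylinder_1_pos)
  define T where "T y = (+) y ` cylinder (\<delta> / 2)" for y
  have T_meas: "T y \<in> lmeasurable" for y
    unfolding T_def by (intro measurable_translation lmeasurable_cylinder)
  have measure_T: "measure lebesgue (T y) = (\<delta> / 2) ^ card J * V" for y
    using measure_cylinder[of "\<delta> / 2"] assms(3) unfolding T_def V_def
    by (simp only: measure_translation half_gt_zero)
  have projP: "proj y = y" if "y \<in> P" for y
    using that assms(2) by (intro proj_id) (auto simp: unit_ball_def)
  have disj: "pairwise (\<lambda>x y. disjnt (T x) (T y)) P"
  proof (rule pairwiseI)
    fix x y assume xy: "x \<in> P" "y \<in> P" "x \<noteq> y"
    show "disjnt (T x) (T y)"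
    proof (rule ccontr)
      assume "\<not> disjnt (T x) (T y)"
      then obtain u v where uv: "u \<in> cylinder (\<delta> / 2)" "v \<in> cylinder (\<delta> / 2)" "x + u = y + v"
        by (auto simp: T_def disjnt_def)
      then have "x - y = v - u" by (simp add: algebra_simps)
      \<comment> \<open>\<open>proj\<close> fixes \<open>x\<close> and \<open>y\<close> and replaces
        \<open>u\<close>, \<open>v\<close> by vectors whose \<open>p\<close>-value the cylinder
        bounds.\<close>
      then have "x - y = proj v - proj u"
        using projP[OF xy(1)] projP[OF xy(2)] linear_diff[OF linear_proj] by metis
      then have "p (x - y) \<le> p (proj v) + p (proj u)"
        using triangle[of "proj v" "- proj u"] by (simp add: p_minus)
      also have "\<dots> \<le> \<delta>"
        using uv by (auto simp: cylinder_def)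
      finally show False
        using pairwiseD[OF sep xy] by simp
    qed
  qed
  have sub: "(\<Union>y\<in>P. T y) \<subseteq> cylinder (1 + \<delta> / 2)"
  proof
    fix z assume "z \<in> (\<Union>y\<in>P. T y)"
    then obtain y u where yu: "y \<in> P" "u \<in> cylinder (\<delta> / 2)" "z = y + u"
      by (auto simp: T_def)
    have y: "p y \<le> 1" "\<And>i. i \<notin> J \<Longrightarrow> y $ i = 0"
      using yu(1) assms(2) by (auto simp: unit_ball_def)
    have "p (proj z) \<le> p y + p (proj u)"
      using triangle[of y "proj u"] projP[OF yu(1)] linear_add[OF linear_proj, of y u] yu(3) by simp
    then show "z \<in> cylinder (1 + \<delta> / 2)"
      using yu y by (auto simp: cylinder_def)
  qed
  have "real (card P) * ((\<delta> / 2) ^ card J * V) = measure lebesgue (\<Union>y\<in>P. T y)"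
    using measure_UNION'[OF assms(1) T_meas disj] by (simp add: measure_T)
  also have "\<dots> \<le> measure lebesgue (cylinder (1 + \<delta> / 2))"
    using T_meas by (intro measure_mono_fmeasurable sub lmeasurable_cylinder sets.finite_UN assms(1)) auto
  also have "\<dots> = (1 + \<delta> / 2) ^ card J * V"
    using assms(3) unfolding V_def by (intro measure_cylinder) auto
  finally have "real (card P) * (\<delta> / 2) ^ card J \<le> (1 + \<delta> / 2) ^ card J"
    using V by (simp add: mult.assoc[symmetric])
  then have "real (card P) \<le> (1 + \<delta> / 2) ^ card J / (\<delta> / 2) ^ card J"
    using assms(3) by (simp add: pos_le_divide_eq)
  also have "\<dots> = (1 + 2 / \<delta>) ^ card J"
  proof -
    have "(1 + \<delta> / 2) / (\<delta> / 2) = 1 + 2 / \<delta>"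
      using assms(3) by (simp add: field_simps)
    then show ?thesis
      by (simp only: power_divide[symmetric])
  qed
  finally show ?thesis .
qed

text \<open>A separated subset of largest cardinality is a net, because a point farther than
  \<open>\<delta>\<close> from all of it could be added. The packing bound shows that a largest one
  exists and limits its size.\<close>

lemma exists_net:
  assumes "0 < \<delta>"
  obtains P where "finite P" "P \<subseteq> unit_ball" "real (card P) \<le> (1 + 2 / \<delta>) ^ card J"
    "\<And>x. x \<in> unit_ball \<Longrightarrow> \<exists>y\<in>P. p (x - y) \<le> \<delta>"
proof -
  define Q where "Q P \<longleftrightarrow> finite P \<and> P \<subseteq> unit_ball \<and> pairwise (\<lambda>x y. \<delta> < p (x - y)) P" for P
  define N where "N = nat \<lceil>(1 + 2 / \<delta>) ^ card J\<rceil>"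
  have "card P < Suc N" if "Q P" for P
    using card_separated_le[of P \<delta>] that assms unfolding Q_def N_def by linarith
  moreover have "Q {}" by (simp add: Q_def)
  ultimately obtain P where P: "Q P" and max: "\<And>P'. Q P' \<Longrightarrow> card P' \<le> card P"
    using ex_has_greatest_nat[of Q "{}" card "Suc N"] by blast
  have "\<exists>y\<in>P. p (x - y) \<le> \<delta>" if x: "x \<in> unit_ball" for x
  proof (rule ccontr)
    assume "\<not> ?thesis"
    then have far: "\<delta> < p (x - y)" "\<delta> < p (y - x)" if "y \<in> P" for y
      using that p_diff_commute[of x y] by force+
    then have "x \<notin> P" using assms p_zero by force
    moreover have "Q (insert x P)"
      using P x far by (auto simp: Q_def pairwise_insert)
    ultimately show False
      using max[of "insert x P"] P by (simp add: Q_def)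
  qed
  with P show thesis
    using that card_separated_le[of P \<delta>] assms unfolding Q_def by blast
qed

end

section \<open>Coordinates for the range of a matrix\<close>

text \<open>\<open>J\<close> indexes columns that form a basis of the column space, so on vectors
  supported on \<open>J\<close> the map is injective and already attains its whole range. This
  brings the range into the form that \<open>coordinate_norm\<close> needs.\<close>

lemma column_basis_coordinates:
  fixes A :: "real ^ 'n ^ 'm"
  obtains J where "card J = rank A"
    "\<And>x. (\<And>i. i \<notin> J \<Longrightarrow> x $ i = 0) \<Longrightarrow> A *v x = 0 \<Longrightarrow> x = 0"
    "\<And>x. \<exists>y. (\<forall>i. i \<notin> J \<longrightarrow> y $ i = 0) \<and> A *v y = A *v x"
proof -
  obtain B where B: "B \<subseteq> columns A" "independent B" "columns A \<subseteq> span B" "card B = dim (columns A)"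
    using basis_exists by blast
  have finB: "finite B" using B(2) independent_bound by blast
  have "\<forall>b\<in>B. \<exists>i. column i A = b" using B(1) by (auto simp: columns_def)
  \<comment> \<open>A column may occur at several indices; \<open>c\<close> selects one of them for
    each basis vector.\<close>
  then obtain c where c: "\<And>b. b \<in> B \<Longrightarrow> column (c b) A = b" by metis
  have inj: "inj_on c B" by (metis c inj_onI)
  define J where "J = c ` B"
  have Av: "A *v x = (\<Sum>b\<in>B. x $ c b *\<^sub>R b)" if "\<And>i. i \<notin> J \<Longrightarrow> x $ i = 0" for x
  proof -
    have "A *v x = (\<Sum>i\<in>UNIV. x $ i *\<^sub>R column i A)"
      by (simp add: matrix_mult_sum scalar_mult_eq_scaleR)
    also have "\<dots> = (\<Sum>i\<in>J. x $ i *\<^sub>R column i A)"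
      using that by (intro sum.mono_neutral_right) auto
    also have "\<dots> = (\<Sum>b\<in>B. x $ c b *\<^sub>R b)"
      unfolding J_def using c by (simp add: sum.reindex[OF inj])
    finally show ?thesis .
  qed
  show thesis
  proof
    show "card J = rank A"
      unfolding J_def using B(4) by (simp add: card_image[OF inj] column_rank_def)
  next
    fix x :: "real ^ 'n" assume x: "\<And>i. i \<notin> J \<Longrightarrow> x $ i = 0" "A *v x = 0"
    have "x $ c b = 0" if "b \<in> B" for b
      using independentD[OF B(2) finB order_refl, of "\<lambda>b. x $ c b" b] Av[OF x(1)] x(2) that by simp
    then have "x $ i = 0" for i
      using x(1)[of i] by (cases "i \<in> J") (auto simp: J_def)
    then show "x = 0"
      by (simp add: vec_eq_iff)
  next
    fix x :: "real ^ 'n"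
    have "A *v x \<in> span B"
      using matrix_vector_mult_in_columnspace[of A x] B(3) span_mono span_span by blast
    then obtain u where u: "A *v x = (\<Sum>b\<in>B. u b *\<^sub>R b)"
      using span_finite[OF finB] by auto
    define y where "y = (\<chi> i. if i \<in> J then u (inv_into B c i) else 0)"
    have "A *v y = (\<Sum>b\<in>B. y $ c b *\<^sub>R b)"
      by (rule Av) (simp add: y_def)
    also have "\<dots> = (\<Sum>b\<in>B. u b *\<^sub>R b)"
      by (intro sum.cong) (auto simp: y_def J_def inv_into_f_f[OF inj])
    finally show "\<exists>y. (\<forall>i. i \<notin> J \<longrightarrow> y $ i = 0) \<and> A *v y = A *v x"
      using u by (intro exI[of _ y]) (auto simp: y_def)
  qed
qed

section \<open>Splitting the rows\<close>

lemma row_inner_eq: "row i A \<bullet> x = (A *v x) $ i"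
  by (simp add: matrix_vector_mul_component row_def)

lemma submatrix_lq_norm_eq: "submatrix_lq_norm q A \<Omega> x = lq_norm_on q \<Omega> (($) (A *v x))"
  by (simp add: submatrix_lq_norm_def row_inner_eq)

lemma submatrix_lq_norm_scaleR:
  "0 < q \<Longrightarrow> submatrix_lq_norm q A \<Omega> (c *\<^sub>R x) = \<bar>c\<bar> * submatrix_lq_norm q A \<Omega> x"
  using lq_norm_on_cmult[of q \<Omega> c "\<lambda>i. row i A \<bullet> x"]
  by (simp add: submatrix_lq_norm_def)

lemma submatrix_lq_norm_triangle:
  fixes A :: "real ^ 'n ^ 'm"
  assumes "1 \<le> q"
  shows "submatrix_lq_norm q A \<Omega> (x + y) \<le> submatrix_lq_norm q A \<Omega> x + submatrix_lq_norm q A \<Omega> y"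
  using lq_norm_on_triangle[OF assms, of \<Omega> "\<lambda>i. row i A \<bullet> x" "\<lambda>i. row i A \<bullet> y"]
  by (simp add: submatrix_lq_norm_def inner_add_right)

lemma submatrix_lq_norm_UNIV: "submatrix_lq_norm q A UNIV x = lq_norm q (A *v x)"
  by (simp add: submatrix_lq_norm_eq lq_norm_def)

lemma submatrix_lq_norm_le:
  fixes A :: "real ^ 'n ^ 'm"
  assumes "0 < q"
  shows "submatrix_lq_norm q A \<Omega> x \<le> lq_norm q (A *v x)"
  using lq_norm_on_mono[OF assms, of UNIV \<Omega> "($) (A *v x)"]
  by (simp add: submatrix_lq_norm_eq lq_norm_def)

text \<open>\<open>upper\<close> is Cauchy-Schwarz in each row. For \<open>lower\<close>, an
  injective linear map on a closed subspace is bounded below in the Euclidean norm; passing through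
  the l1-norm, each coordinate being at most the lq-norm, costs the factor
  \<open>CARD('m)\<close>.\<close>

lemma exists_coordinate_norm:
  fixes A :: "real ^ 'n ^ 'm"
  assumes q: "1 \<le> q" and J: "\<And>x. (\<And>i. i \<notin> J \<Longrightarrow> x $ i = 0) \<Longrightarrow> A *v x = 0 \<Longrightarrow> x = 0"
  shows "\<exists>e C. coordinate_norm (\<lambda>x. lq_norm q (A *v x)) J e C"
proof -
  have q0: "0 < q" using q by simp
  define V where "V = {x :: real ^ 'n. \<forall>i. i \<notin> J \<longrightarrow> x $ i = 0}"
  have subV: "subspace V"
    by (simp add: V_def subspace_def)
  have "\<exists>e>0. \<forall>x\<in>V. norm (A *v x) \<ge> e * norm x"
  proof (rule injective_imp_isometric[OF closed_subspace[OF subV] subV])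
    show "bounded_linear ((*v) A)"
      by (rule matrix_vector_mul_bounded_linear)
    show "\<forall>x\<in>V. A *v x = 0 \<longrightarrow> x = 0"
      using J by (auto simp: V_def)
  qed
  then obtain e where e: "0 < e" "\<And>x. x \<in> V \<Longrightarrow> e * norm x \<le> norm (A *v x)"
    by blast
  define C where "C = lq_norm_on q UNIV (\<lambda>i. norm (row i A))"
  have "coordinate_norm (\<lambda>x. lq_norm q (A *v x)) J (e / real CARD('m)) C"
  proof
    fix c x
    show "lq_norm q (A *v c *\<^sub>R x) = \<bar>c\<bar> * lq_norm q (A *v x)"
      using submatrix_lq_norm_scaleR[OF q0, of A UNIV] by (simp add: submatrix_lq_norm_UNIV)
  next
    fix x y
    show "lq_norm q (A *v (x + y)) \<le> lq_norm q (A *v x) + lq_norm q (A *v y)"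
      using submatrix_lq_norm_triangle[OF q, of A UNIV] by (simp add: submatrix_lq_norm_UNIV)
  next
    fix x
    have "lq_norm q (A *v x) \<le> lq_norm_on q UNIV (\<lambda>i. norm x * norm (row i A))"
      unfolding lq_norm_def row_inner_eq[symmetric] using q0
      by (intro lq_norm_on_mono_fun) (auto simp: Cauchy_Schwarz_ineq2 mult.commute[of "norm x"])
    then show "lq_norm q (A *v x) \<le> C * norm x"
      using lq_norm_on_cmult[OF q0, of UNIV "norm x" "\<lambda>i. norm (row i A)"]
      by (simp add: C_def mult.commute)
  next
    fix x :: "real ^ 'n" assume "\<And>i. i \<notin> J \<Longrightarrow> x $ i = 0"
    then have "e * norm x \<le> norm (A *v x)"
      by (intro e(2)) (simp add: V_def)
    also have "\<dots> \<le> (\<Sum>i\<in>UNIV. \<bar>(A *v x) $ i\<bar>)"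
      by (rule norm_le_l1_cart)
    also have "\<dots> \<le> real CARD('m) * lq_norm q (A *v x)"
      unfolding lq_norm_def using q0 by (intro sum_bounded_above abs_le_lq_norm_on) auto
    finally show "e / real CARD('m) * norm x \<le> lq_norm q (A *v x)"
      by (simp add: divide_le_eq mult.commute)
  next
    show "0 < e / real CARD('m)" using e(1) by simp
  qed
  then show ?thesis by blast
qed

text \<open>Here \<open>\<delta>\<close> is the mesh of the net, \<open>s\<close> the imbalance
  allowed at net points, and \<open>small\<close> the union bound over the net. Net points yield the
  first summand of the factor; approximating a general \<open>x\<close> adds
  \<open>\<delta>\<close>, since restricting the rows cannot increase the norm of the error.\<close>

lemma exists_splitting:
  fixes A :: "real ^ 'n ^ 'm"
  assumes q: "1 \<le> q" and \<epsilon>: "0 < \<epsilon>" and \<delta>: "0 < \<delta>" and s: "0 < s"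
    and flat: "\<And>x i. \<bar>(A *v x) $ i\<bar> \<le> \<epsilon> * lq_norm q (A *v x)"
    and small: "2 * (1 + 2 / \<delta>) ^ rank A < exp (s\<^sup>2 / (4 * \<epsilon> powr q))"
  shows "\<exists>\<Omega>. \<forall>x. \<forall>\<Omega>'\<in>{\<Omega>, - \<Omega>}.
    submatrix_lq_norm q A \<Omega>' x \<le> (2 powr (- 1 / q) * (1 + s / q) + \<delta>) * lq_norm q (A *v x)"
proof -
  have q0: "0 < q" using q by simp
  obtain J where J: "card J = rank A" "\<And>x. (\<And>i. i \<notin> J \<Longrightarrow> x $ i = 0) \<Longrightarrow> A *v x = 0 \<Longrightarrow> x = 0"
    "\<And>x. \<exists>y. (\<forall>i. i \<notin> J \<longrightarrow> y $ i = 0) \<and> A *v y = A *v x"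
    using column_basis_coordinates[of A] by blast
  obtain e C where "coordinate_norm (\<lambda>x. lq_norm q (A *v x)) J e C"
    using exists_coordinate_norm[OF q J(2)] by blast
  then interpret coordinate_norm "\<lambda>x. lq_norm q (A *v x)" J e C .
  obtain P where P: "finite P" "P \<subseteq> unit_ball" "real (card P) \<le> (1 + 2 / \<delta>) ^ card J"
    "\<And>x. x \<in> unit_ball \<Longrightarrow> \<exists>y\<in>P. lq_norm q (A *v (x - y)) \<le> \<delta>"
    using exists_net[OF \<delta>] by blast
  define a where "a y i = \<bar>(A *v y) $ i\<bar> powr q" for y i
  have le1: "lq_norm q (A *v y) \<le> 1" if "y \<in> P" for y
    using that P(2) by (auto simp: unit_ball_def)
  have sum_a: "sum (a y) UNIV \<le> 1" if "y \<in> P" for y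
  proof -
    have "sum (a y) UNIV = lq_norm q (A *v y) powr q"
      unfolding a_def lq_norm_def by (simp add: lq_norm_on_powr[OF q0])
    also have "\<dots> \<le> 1"
      using le1[OF that] q0 p_nonneg by (simp add: powr_le1)
    finally show ?thesis .
  qed
  \<comment> \<open>Flatness bounds each \<open>a y i\<close> by \<open>\<epsilon> powr q\<close>,
    and the \<open>a y i\<close> sum to at most 1, so the sum of squares is at most
    \<open>\<epsilon> powr q\<close>.\<close>
  have sq: "(\<Sum>i\<in>UNIV. (a y i)\<^sup>2) \<le> \<epsilon> powr q" if y: "y \<in> P" for y
  proof -
    have "a y i \<le> \<epsilon> powr q" for i
    proof -
      have "\<bar>(A *v y) $ i\<bar> \<le> \<epsilon> * 1"
        using flat[of y i] mult_left_mono[OF le1[OF y], of \<epsilon>] \<epsilon> by linarith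
      then show ?thesis
        unfolding a_def using q0 by (intro powr_mono2) auto
    qed
    then have "(\<Sum>i\<in>UNIV. (a y i)\<^sup>2) \<le> (\<Sum>i\<in>UNIV. \<epsilon> powr q * a y i)"
      by (intro sum_mono) (auto simp: power2_eq_square a_def intro: mult_right_mono)
    also have "\<dots> = \<epsilon> powr q * sum (a y) UNIV"
      by (simp add: sum_distrib_left)
    also have "\<dots> \<le> \<epsilon> powr q"
      using sum_a[OF y] by (simp add: mult_left_le)
    finally show ?thesis .
  qed
  have "2 * real (card P) < exp (s\<^sup>2 / (4 * \<epsilon> powr q))"
    using P(3) small J(1) by simp
  then obtain \<Omega> where \<Omega>: "\<And>y. y \<in> P \<Longrightarrow> \<bar>sum (a y) \<Omega> - sum (a y) (UNIV - \<Omega>)\<bar> \<le> s"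
    using exists_balanced_subset[of UNIV P s "\<epsilon> powr q" a] P(1) s \<epsilon> sq by auto
  define \<beta> where "\<beta> = 2 powr (- 1 / q) * (1 + s / q)"
  have net_bound: "submatrix_lq_norm q A \<Omega>' y \<le> \<beta>" if y: "y \<in> P" and \<Omega>': "\<Omega>' \<in> {\<Omega>, - \<Omega>}" for y \<Omega>'
  proof -
    have "sum (a y) UNIV = sum (a y) \<Omega> + sum (a y) (UNIV - \<Omega>)"
      using sum.subset_diff[of \<Omega> UNIV "a y"] by simp
    \<comment> \<open>Two numbers with sum at most 1 and difference at most \<open>s\<close> are
      each at most \<open>(1 + s) / 2\<close>.\<close>
    then have "sum (a y) \<Omega>' \<le> (1 + s) / 2"
      using \<Omega>[OF y] sum_a[OF y] \<Omega>' by (auto simp: Compl_eq_Diff_UNIV)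
    then have "submatrix_lq_norm q A \<Omega>' y \<le> ((1 + s) / 2) powr (1 / q)"
      unfolding submatrix_lq_norm_eq lq_norm_on_def a_def using q0
      by (intro powr_mono2) (auto intro: sum_nonneg)
    also have "\<dots> = 2 powr (- 1 / q) * (1 + s) powr (1 / q)"
      using s by (simp add: powr_divide powr_minus_divide)
    also have "\<dots> \<le> \<beta>"
      unfolding \<beta>_def using one_plus_powr_le[OF q, of s] s by (intro mult_left_mono) auto
    finally show ?thesis .
  qed
  have "submatrix_lq_norm q A \<Omega>' x \<le> (\<beta> + \<delta>) * lq_norm q (A *v x)"
    if \<Omega>': "\<Omega>' \<in> {\<Omega>, - \<Omega>}" for \<Omega>' x
  proof (cases "lq_norm q (A *v x) = 0")
    case True
    then show ?thesis
      using submatrix_lq_norm_le[OF q0, of A \<Omega>' x] by simp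
  next
    case False
    define r where "r = lq_norm q (A *v x)"
    have r: "0 < r" using False p_nonneg[of x] by (simp add: r_def)
    \<comment> \<open>The net consists of vectors supported on \<open>J\<close>, so \<open>x\<close>
      is exchanged for such a vector with the same image and then normalised.\<close>
    obtain y where y: "\<And>i. i \<notin> J \<Longrightarrow> y $ i = 0" "A *v y = A *v x"
      using J(3)[of x] by blast
    define z where "z = (1 / r) *\<^sub>R y"
    have "lq_norm q (A *v z) = 1"
      unfolding z_def using r by (simp only: scale y(2)) (simp add: r_def)
    then have "z \<in> unit_ball"
      using y(1) by (simp add: unit_ball_def z_def)
    then obtain w where w: "w \<in> P" "lq_norm q (A *v (z - w)) \<le> \<delta>"
      using P(4) by blast
    have "submatrix_lq_norm q A \<Omega>' z \<le> submatrix_lq_norm q A \<Omega>' w + submatrix_lq_norm q A \<Omega>' (z - w)"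
      using submatrix_lq_norm_triangle[OF q, of A \<Omega>' w "z - w"] by simp
    also have "\<dots> \<le> \<beta> + \<delta>"
      using net_bound[OF w(1) \<Omega>'] submatrix_lq_norm_le[OF q0, of A \<Omega>' "z - w"] w(2) by linarith
    finally have "r * submatrix_lq_norm q A \<Omega>' z \<le> r * (\<beta> + \<delta>)"
      using r by simp
    moreover have "submatrix_lq_norm q A \<Omega>' x = submatrix_lq_norm q A \<Omega>' (r *\<^sub>R z)"
      using r y(2) by (simp add: submatrix_lq_norm_eq z_def)
    ultimately show ?thesis
      using r by (simp add: submatrix_lq_norm_scaleR[OF q0] r_def[symmetric] mult.commute)
  qed
  then show ?thesis unfolding \<beta>_def by blast
qed

section \<open>Numerical estimates for the parameters\<close>

text \<open>Serves the trivial case, where the constant has to be at least 1. It is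
  \<open>1 + x \<le> exp x\<close> at \<open>x = - ln 2 / q\<close>, with
  \<open>ln 2 < 1\<close>.\<close>

lemma two_powr_minus_inverse_ge:
  fixes q :: real
  assumes "1 \<le> q"
  shows "1 - 1 / q \<le> 2 powr (- 1 / q)"
proof -
  have "1 - 1 / q \<le> 1 - ln 2 / q"
    using assms ln_2_less_1 by (simp add: divide_right_mono)
  also have "\<dots> \<le> exp (- ln 2 / q)"
    using exp_ge_add_one_self[of "- ln 2 / q"] by simp
  also have "\<dots> = 2 powr (- 1 / q)"
    by (simp add: powr_def)
  finally show ?thesis .
qed

text \<open>With \<open>E = \<epsilon> powr q\<close>, \<open>d = rank A\<close>, mesh
  \<open>2 * T / q\<close> and imbalance \<open>3 * T\<close>, the second claim is the smallness
  condition of the splitting. \<open>T\<close> is chosen so that \<open>T ^ 3 = R * L\<close>, that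
  is \<open>d * L = T ^ 3 / E\<close>, which for \<open>T < 1\<close> lies below
  \<open>9 * T\<^sup>2 / (4 * E)\<close>.\<close>

lemma entropy_estimate:
  fixes q R T E :: real and d :: nat
  assumes q: "1 \<le> q" and d: "0 < d" and E: "0 < E" and R: "R = real d * E" "R \<le> 1"
    and T: "T = (R * ln (6 * q / R powr (1 / 3))) powr (1 / 3)" "T < 1"
  shows "0 < T" "2 * (1 + q / T) ^ d < exp ((3 * T)\<^sup>2 / (4 * E))"
proof -
  define L where "L = ln (6 * q / R powr (1 / 3))"
  have R0: "0 < R" using R d E by simp
  have root: "0 < R powr (1 / 3)" "R powr (1 / 3) \<le> 1"
    using R0 R(2) by (auto intro: powr_le1)
  \<comment> \<open>The argument of the logarithm is thus at least 6, above Euler's number; so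
    \<open>L \<ge> 1\<close>, and \<open>T ^ 3 = R * L\<close> will give
    \<open>T \<ge> R powr (1 / 3)\<close>.\<close>
  then have six: "6 * q \<le> 6 * q / R powr (1 / 3)"
    using q by (simp add: le_divide_eq mult_left_le)
  then have "exp 1 \<le> 6 * q / R powr (1 / 3)"
    using exp_le q by linarith
  then have L1: "1 \<le> L"
    unfolding L_def using ln_ge_iff q root(1) by (smt (verit) exp_gt_zero)
  have T3: "T ^ 3 = R * L"
  proof -
    have "T ^ 3 = T powr 3"
      by (simp add: T(1))
    also have "\<dots> = R * L"
      using R0 L1 by (simp add: T(1) L_def[symmetric] powr_powr)
    finally show ?thesis .
  qed
  have TR: "R powr (1 / 3) \<le> T"
    using R0 L1 by (simp add: T(1) L_def[symmetric] powr_mono2)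
  then show T0: "0 < T" using root by linarith
  \<comment> \<open>As \<open>d \<ge> 1\<close>, the factor 2 is absorbed into the d-th power; each
    factor is then at most \<open>6 * (q / T)\<close>, hence at most \<open>exp L\<close>.\<close>
  have "2 * (1 + q / T) ^ d \<le> 2 ^ d * (1 + q / T) ^ d"
    using self_le_power[of "2 :: real" d] d q T0 by (intro mult_right_mono) auto
  also have "\<dots> = (2 + 2 * (q / T)) ^ d"
    by (simp add: power_mult_distrib[symmetric] distrib_left)
  also have "\<dots> \<le> exp L ^ d"
  proof (rule power_mono)
    have "1 \<le> q / T"
      using q T0 T(2) by (simp add: le_divide_eq)
    then have "2 + 2 * (q / T) \<le> 6 * (q / T)"
      by simp
    also have "\<dots> \<le> 6 * q / R powr (1 / 3)"
      using TR root q by (simp add: frac_le)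
    also have "\<dots> = exp L"
      using q root by (simp add: L_def)
    finally show "2 + 2 * (q / T) \<le> exp L" .
    show "0 \<le> 2 + 2 * (q / T)" using q T0 by simp
  qed
  also have "\<dots> = exp (real d * L)"
    by (simp add: exp_of_nat_mult)
  also have "\<dots> < exp ((3 * T)\<^sup>2 / (4 * E))"
  proof -
    have "real d * L * (4 * E) = 4 * T ^ 3"
      using T3 R(1) by simp
    also have "\<dots> = 4 * (T * T\<^sup>2)"
      by (simp add: power2_eq_square power3_eq_cube)
    also have "\<dots> < 9 * T\<^sup>2"
      using mult_right_mono[of T 1 "T\<^sup>2"] T(2) T0 by (simp add: less_le_trans)
    finally show ?thesis
      using E by (simp add: less_divide_eq power_mult_distrib)
  qed
  finally show "2 * (1 + q / T) ^ d < exp ((3 * T)\<^sup>2 / (4 * E))" .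
qed

theorem proposition1:
  fixes q \<epsilon> :: real and A :: "real ^ 'n ^ 'm"
  assumes "1 \<le> q"
    and "A \<noteq> 0"
    and "0 < \<epsilon>"
    and "\<epsilon> \<le> real (rank A) powr (- 1 / q)"
    and "\<forall>x :: real ^ 'n. \<forall>i\<^sub>0 :: 'm.
           \<bar>row i\<^sub>0 A \<bullet> x\<bar> \<le> \<epsilon> * (\<Sum>i\<in>UNIV. \<bar>row i A \<bullet> x\<bar> powr q) powr (1 / q)"
  shows "\<exists>\<Omega>\<^sub>1 \<Omega>\<^sub>2 :: 'm set. \<Omega>\<^sub>1 \<union> \<Omega>\<^sub>2 = UNIV \<and> \<Omega>\<^sub>1 \<inter> \<Omega>\<^sub>2 = {} \<and>
           (\<forall>x :: real ^ 'n. \<forall>\<Omega> \<in> {\<Omega>\<^sub>1, \<Omega>\<^sub>2}.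
              submatrix_lq_norm q A \<Omega> x \<le>
                (1 / 2 powr (1 / q) +
                 (2 + 3 * 2 powr (- 1 / q)) / q *
                   (real (rank A) * \<epsilon> powr q *
                    ln (6 * q / (real (rank A) * \<epsilon> powr q) powr (1 / 3))) powr (1 / 3)) *
                lq_norm q (A *v x))"
proof -
  define R where "R = real (rank A) * \<epsilon> powr q"
  define T where "T = (R * ln (6 * q / R powr (1 / 3))) powr (1 / 3)"
  define h where "h = 2 powr (- 1 / q)"
  have q0: "0 < q" using assms(1) by simp
  have d: "0 < rank A"
    using assms(2) rank_eq_0[of A] by simp
  have h: "1 / 2 powr (1 / q) = h"
    by (simp add: h_def powr_minus_divide)
  have "\<epsilon> powr q \<le> (real (rank A) powr (- 1 / q)) powr q"
    using assms(3,4) q0 by (intro powr_mono2) auto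
  also have "\<dots> = real (rank A) powr (- 1)"
    using q0 by (simp add: powr_powr)
  also have "\<dots> = 1 / real (rank A)"
    using d by (simp add: powr_minus_divide)
  finally have R1: "R \<le> 1"
    using d by (simp add: R_def field_simps)
  have "\<exists>\<Omega>. \<forall>x. \<forall>\<Omega>'\<in>{\<Omega>, - \<Omega>}.
      submatrix_lq_norm q A \<Omega>' x \<le> (h + (2 + 3 * h) / q * T) * lq_norm q (A *v x)"
  proof (cases "T < 1")
    case True
    have T0: "0 < T" and count: "2 * (1 + q / T) ^ rank A < exp ((3 * T)\<^sup>2 / (4 * \<epsilon> powr q))"
      using entropy_estimate[OF assms(1) d _ R_def R1 T_def True] assms(3) by simp_all
    have flat: "\<bar>(A *v x) $ i\<bar> \<le> \<epsilon> * lq_norm q (A *v x)" for x i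
      using assms(5) by (simp add: row_inner_eq lq_norm_def lq_norm_on_def)
    \<comment> \<open>Origin of \<open>2 + 3 * h\<close>: the mesh contributes
      \<open>2 * T / q\<close>, the imbalance \<open>3 * T\<close> contributes
      \<open>h * (3 * T / q)\<close>.\<close>
    have "h * (1 + 3 * T / q) + 2 * T / q = h + (2 + 3 * h) / q * T"
      by (simp add: algebra_simps add_divide_distrib)
    then show ?thesis
      using exists_splitting[OF assms(1,3), of "2 * T / q" "3 * T" A, OF _ _ flat] count T0 q0
      by (simp add: h_def)
  next
    case False
    \<comment> \<open>For \<open>T \<ge> 1\<close> the factor is at least 1, so any
      \<open>\<Omega>\<close> does, by monotonicity of the norm in the set of rows.\<close>
    have "1 \<le> h + 1 / q"
      using two_powr_minus_inverse_ge[OF assms(1)] by (simp add: h_def)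
    also have "1 / q \<le> (2 + 3 * h) / q * T"
    proof -
      have "1 \<le> (2 + 3 * h) * T"
        using mult_mono[of 1 "2 + 3 * h" 1 T] False by (simp add: h_def)
      then show ?thesis
        using q0 by (simp add: divide_right_mono)
    qed
    finally have "1 \<le> h + (2 + 3 * h) / q * T" by simp
    then have "submatrix_lq_norm q A \<Omega> x \<le> (h + (2 + 3 * h) / q * T) * lq_norm q (A *v x)" for \<Omega> x
      using mult_right_mono[of 1 "h + (2 + 3 * h) / q * T" "lq_norm q (A *v x)"]
        submatrix_lq_norm_le[OF q0, of A \<Omega> x] by (simp add: lq_norm_def)
    then show ?thesis by blast
  qed
  then obtain \<Omega> where "\<forall>x. \<forall>\<Omega>'\<in>{\<Omega>, - \<Omega>}.
      submatrix_lq_norm q A \<Omega>' x \<le> (h + (2 + 3 * h) / q * T) * lq_norm q (A *v x)"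
    by blast
  then show ?thesis
    unfolding T_def R_def h h_def[symmetric]
    by (intro exI[of _ \<Omega>] exI[of _ "- \<Omega>"]) simp
qed

end
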